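(* Let $0\le a_0<a_1<\cdots$, let $\varphi_{m,k}\in C_b[0,\infty)$ for $m\in\mathbb{N}$, $k\in\mathbb{N}_0$, and let $$T_m(f(t);x):=\sum_{k=0}^\infty\varphi_{m,k}(x)f\left(\frac{a_k}{m}\right),\quad f\in C_b[0,\infty),\ x\ge0,$$ where the series is assumed to converge for all such $m,f,x$. Then the following three conditions are equivalent: (i) $T_{m\nu}\left(f(\nu t);\frac{x}{\nu}\right)=T_m(f(t);x)$ for all integers $m,\nu\ge1$, all $x\ge0$ and all $f\in C_b[0,\infty)$; (ii) $\varphi_{m\nu,k}(x)=\varphi_{m,k}(\nu x)$ for all $m,\nu\in\mathbb{N}$, $k\in\mathbb{N}_0$, $x\ge0$; (iii) $\varphi_{m,k}(x)=\varphi_{1,k}(mx)$ for all $m\in\mathbb{N}$, $k\in\mathbb{N}_0$, $x\ge0$.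
   Context: $C_b[0,\infty)$ is the space of real-valued continuous bounded functions on $[0,\infty)$; $\mathbb{N}=\{1,2,\dots\}$, $\mathbb{N}_0=\mathbb{N}\cup\{0\}$. The notation $T_{m\nu}(f(\nu t);x/\nu)$ means $T_{m\nu}$ applied to the function $t\mapsto f(\nu t)$, evaluated at $x/\nu$. *)

theory Defs
  imports "HOL-Analysis.Analysis"
begin

text \<open>The half-line is not a type of its own, so an element of \<open>C\<^sub>b[0,\<infinity>)\<close> is
  represented by a total function on the reals; its values at negative arguments are irrelevant.\<close>

definition Cb :: "(real \<Rightarrow> real) set" where
  "Cb = {f. continuous_on {0..} f \<and> bounded (f ` {0..})}"

definition T_term ::
  "(nat \<Rightarrow> real) \<Rightarrow> (nat \<Rightarrow> nat \<Rightarrow> real \<Rightarrow> real) \<Rightarrow> nat \<Rightarrow> (real \<Rightarrow> real) \<Rightarrow> real \<Rightarrow> nat \<Rightarrow> real" where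
  "T_term a \<phi> m f x k = \<phi> m k x * f (a k / real m)"

text \<open>\<open>T_op a \<phi> m f x\<close> is \<open>T\<^sub>m(f(t);x)\<close>; it is meaningful only for \<open>m \<ge> 1\<close>, \<open>x \<ge> 0\<close> and when the
  terms are summable.\<close>

definition T_op ::
  "(nat \<Rightarrow> real) \<Rightarrow> (nat \<Rightarrow> nat \<Rightarrow> real \<Rightarrow> real) \<Rightarrow> nat \<Rightarrow> (real \<Rightarrow> real) \<Rightarrow> real \<Rightarrow> real" where
  "T_op a \<phi> m f x = (\<Sum>k. T_term a \<phi> m f x k)"

end

theory Submission
  imports Defs
begin

text \<open>The dilation in (i) leaves the nodes in place: at parameter \<open>m\<nu>\<close> the function
  \<open>t \<mapsto> f (\<nu>t)\<close> is sampled at \<open>a\<^sub>k/(m\<nu>)\<close>, where it takes the value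
  \<open>f (a\<^sub>k/m)\<close>. Hence both sides of (i) are series in the same numbers \<open>f (a\<^sub>k/m)\<close>, with
  coefficients \<open>\<phi>\<^bsub>m\<nu>,k\<^esub>(x/\<nu>)\<close> and \<open>\<phi>\<^bsub>m,k\<^esub>(x)\<close>, and (i) says that these series agree for every \<open>f\<close>
  (\<open>T_op_dilate\<close>). Replacing \<open>x\<close> by \<open>\<nu>x\<close> turns equality of the coefficients into (ii), so (ii)
  implies (i). For the converse each coefficient has to be recovered from its operator
  (\<open>T_op_cardinal\<close>). This is possible because a strictly increasing sequence consists of isolated
  points (\<open>strict_mono_isolated\<close>): a narrow tent around \<open>a\<^sub>k/m\<close> is a bounded continuous function
  that is \<open>1\<close> at \<open>a\<^sub>k/m\<close> and \<open>0\<close> at all other nodes (\<open>ex_Cb_cardinal\<close>).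

  Condition (iii) is the case \<open>m = 1\<close> of (ii), and using it for both \<open>m\<nu>\<close> and \<open>m\<close> gives (ii)
  back, because \<open>(m\<nu>)x = m(\<nu>x)\<close>.\<close>

text \<open>By monotonicity only the two neighbours of \<open>a k\<close> can be closest to it. At \<open>k = 0\<close> the gap to the
  left is the spurious \<open>a 0 - a 0 = 0\<close>, so it must be left out there.\<close>

lemma strict_mono_isolated:
  fixes a :: "nat \<Rightarrow> real"
  assumes "strict_mono a"
  obtains d where "d > 0" "\<And>j. j \<noteq> k \<Longrightarrow> d \<le> \<bar>a j - a k\<bar>"
proof
  define l where "l = (if k = 0 then 1 else a k - a (k - 1))"
  define d where "d = min l (a (Suc k) - a k)"
  have "l > 0"
    using assms by (simp add: l_def strict_mono_less)
  then show "d > 0"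
    using assms by (simp add: d_def strict_mono_less)
  show "d \<le> \<bar>a j - a k\<bar>" if "j \<noteq> k" for j
  proof (cases "j < k")
    case True
    then have "a j \<le> a (k - 1)"
      using assms by (simp add: strict_mono_less_eq)
    with True show ?thesis
      by (simp add: d_def l_def)
  next
    case False
    with that have "a (Suc k) \<le> a j"
      using assms by (simp add: strict_mono_less_eq)
    then show ?thesis
      by (simp add: d_def)
  qed
qed

text \<open>The function is a tent in the variable \<open>mt\<close>: its peak is at \<open>a k\<close>, and it vanishes at every
  other node because its half-width is at most the distance to the nearest one.\<close>

lemma ex_Cb_cardinal:
  fixes a :: "nat \<Rightarrow> real"
  assumes "strict_mono a" "m \<ge> 1"
  obtains f where "f \<in> Cb" "\<And>j. f (a j / real m) = of_bool (j = k)"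
proof -
  obtain d where d: "d > 0" "\<And>j. j \<noteq> k \<Longrightarrow> d \<le> \<bar>a j - a k\<bar>"
    using strict_mono_isolated[OF assms(1), of k] by blast
  define f where "f = (\<lambda>t. max 0 (1 - \<bar>real m * t - a k\<bar> / d))"
  have "continuous_on {0..} f"
    unfolding f_def using d(1) by (intro continuous_intros) auto
  moreover have "bounded (f ` {0..})"
  proof (rule boundedI)
    fix y assume "y \<in> f ` {0..}"
    then show "norm y \<le> 1"
      using d(1) by (auto simp: f_def)
  qed
  ultimately have "f \<in> Cb"
    by (simp add: Cb_def)
  moreover have "f (a j / real m) = of_bool (j = k)" for j
    using assms(2) d by (cases "j = k") (auto simp: f_def)
  ultimately show thesis
    by (rule that)
qed

lemma T_op_cardinal:
  assumes "\<And>j. f (a j / real m) = of_bool (j = k)"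
  shows "T_op a \<phi> m f x = \<phi> m k x"
proof -
  have "T_op a \<phi> m f x = (\<Sum>j\<in>{k}. T_term a \<phi> m f x j)"
    unfolding T_op_def by (rule suminf_finite) (auto simp: T_term_def assms)
  then show ?thesis
    by (simp add: T_term_def assms)
qed

text \<open>The dilation factor cancels in the node, so that only the coefficients still see \<open>\<nu>\<close>; they are
  those of \<open>T\<^sub>m\<close> for the family \<open>\<phi>\<^bsub>m\<nu>,k\<^esub>\<close>.\<close>

lemma T_op_dilate:
  assumes "\<nu> \<ge> 1"
  shows "T_op a \<phi> (m * \<nu>) (\<lambda>t. f (real \<nu> * t)) y = T_op a (\<lambda>m. \<phi> (m * \<nu>)) m f y"
proof -
  have "real \<nu> * (a k / real (m * \<nu>)) = a k / real m" for k
    using assms by simp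
  then show ?thesis
    by (simp add: T_op_def T_term_def)
qed

theorem theorem12p1:
  fixes a :: "nat \<Rightarrow> real" and \<phi> :: "nat \<Rightarrow> nat \<Rightarrow> real \<Rightarrow> real"
  assumes "0 \<le> a 0" and "strict_mono a"
    and "\<And>m k. m \<ge> 1 \<Longrightarrow> \<phi> m k \<in> Cb"
    and "\<And>m f x. m \<ge> 1 \<Longrightarrow> f \<in> Cb \<Longrightarrow> x \<ge> 0 \<Longrightarrow> summable (T_term a \<phi> m f x)"
  shows "((\<forall>m \<nu> x. \<forall>f\<in>Cb. m \<ge> 1 \<longrightarrow> \<nu> \<ge> 1 \<longrightarrow> x \<ge> 0 \<longrightarrow>
            T_op a \<phi> (m * \<nu>) (\<lambda>t. f (real \<nu> * t)) (x / real \<nu>) = T_op a \<phi> m f x)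
          \<longleftrightarrow> (\<forall>m \<nu> k x. m \<ge> 1 \<longrightarrow> \<nu> \<ge> 1 \<longrightarrow> x \<ge> 0 \<longrightarrow> \<phi> (m * \<nu>) k x = \<phi> m k (real \<nu> * x)))
       \<and> ((\<forall>m \<nu> k x. m \<ge> 1 \<longrightarrow> \<nu> \<ge> 1 \<longrightarrow> x \<ge> 0 \<longrightarrow> \<phi> (m * \<nu>) k x = \<phi> m k (real \<nu> * x))
          \<longleftrightarrow> (\<forall>m k x. m \<ge> 1 \<longrightarrow> x \<ge> 0 \<longrightarrow> \<phi> m k x = \<phi> 1 k (real m * x)))"
    (is "(?i \<longleftrightarrow> ?ii) \<and> (_ \<longleftrightarrow> ?iii)")
proof (intro conjI iffI)
  assume i: ?i
  show ?ii
  proof (intro allI impI)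
    fix m \<nu> k :: nat and x :: real
    assume m: "m \<ge> 1" and \<nu>: "\<nu> \<ge> 1" and x: "x \<ge> 0"
    obtain f where f: "f \<in> Cb" "\<And>j. f (a j / real m) = of_bool (j = k)"
      using ex_Cb_cardinal[OF \<open>strict_mono a\<close> m, of k] by blast
    have "\<phi> (m * \<nu>) k x = T_op a (\<lambda>m. \<phi> (m * \<nu>)) m f x"
      using f(2) by (simp add: T_op_cardinal)
    also have "\<dots> = T_op a \<phi> (m * \<nu>) (\<lambda>t. f (real \<nu> * t)) (real \<nu> * x / real \<nu>)"
      using \<nu> by (simp add: T_op_dilate)
    also have "\<dots> = T_op a \<phi> m f (real \<nu> * x)"
      using i f(1) m \<nu> x by (meson mult_nonneg_nonneg of_nat_0_le_iff)
    also have "\<dots> = \<phi> m k (real \<nu> * x)"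
      using f(2) by (rule T_op_cardinal)
    finally show "\<phi> (m * \<nu>) k x = \<phi> m k (real \<nu> * x)" .
  qed
next
  assume ii: ?ii
  show ?i
  proof (intro allI ballI impI)
    fix m \<nu> :: nat and x :: real and f
    assume m: "m \<ge> 1" and \<nu>: "\<nu> \<ge> 1" and x: "x \<ge> 0"
    have "\<phi> (m * \<nu>) k (x / real \<nu>) = \<phi> m k x" for k
      using ii m \<nu> x by simp
    then show "T_op a \<phi> (m * \<nu>) (\<lambda>t. f (real \<nu> * t)) (x / real \<nu>) = T_op a \<phi> m f x"
      unfolding T_op_dilate[OF \<nu>] by (simp add: T_op_def T_term_def)
  qed
next
  assume ii: ?ii
  show ?iii
  proof (intro allI impI)
    fix m k :: nat and x :: real
    assume "m \<ge> 1" "x \<ge> 0"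
    then show "\<phi> m k x = \<phi> 1 k (real m * x)"
      using ii[rule_format, of 1 m x k] by simp
  qed
next
  assume iii: ?iii
  show ?ii
  proof (intro allI impI)
    fix m \<nu> k :: nat and x :: real
    assume m: "m \<ge> 1" and \<nu>: "\<nu> \<ge> 1" and x: "x \<ge> 0"
    have "\<phi> (m * \<nu>) k x = \<phi> 1 k (real (m * \<nu>) * x)"
      using iii[rule_format, of "m * \<nu>" x k] m \<nu> x by simp
    also have "\<dots> = \<phi> 1 k (real m * (real \<nu> * x))"
      by (simp add: mult.assoc)
    also have "\<dots> = \<phi> m k (real \<nu> * x)"
      using iii[rule_format, of m "real \<nu> * x" k] m x by simp
    finally show "\<phi> (m * \<nu>) k x = \<phi> m k (real \<nu> * x)" .
  qed
qed

end
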